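(* Let $p>3$ be a prime and let $\alpha$ be a $p$-adic integer. Then $$\sum_{k=0}^{p-1}(-1)^k(2k+\alpha)\frac{(\alpha)_k^3}{(1)_k^3}\equiv (-1)^{\langle -\alpha\rangle_p}(\alpha+\langle -\alpha\rangle_p)+(\alpha+\langle -\alpha\rangle_p)^3E_{p-3}(\alpha)\pmod{p^4},$$ and $$\sum_{k=0}^{\langle -\alpha\rangle_p}(-1)^k(2k+\alpha)\frac{(\alpha)_k^3}{(1)_k^3}\equiv (-1)^{\langle -\alpha\rangle_p}(\alpha+\langle -\alpha\rangle_p)+(\alpha+\langle -\alpha\rangle_p)^3E_{p-3}(\alpha)\pmod{p^4}.$$
   Context: $(x)_k=x(x+1)\cdots(x+k-1)$ is the Pochhammer symbol, with $(x)_0=1$. For a $p$-adic integer $x$, $\langle x\rangle_p\in\{0,1,\dots,p-1\}$ denotes the least non-negative residue of $x$ modulo $p$. The Euler polynomials $E_n(x)$ are defined by $\sum_{n\ge 0}E_n(x)\frac{t^n}{n!}=\frac{2e^{xt}}{e^t+1}$. Congruences modulo $p^4$ are in the ring $\mathbb{Z}_p$ of $p$-adic integers, i.e. the difference lies in $p^4\mathbb{Z}_p$. *)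

theory Defs
  imports
    "HOL-Algebra.Ideal"
    "HOL-Computational_Algebra.Computational_Algebra"
    "HOL-Number_Theory.Cong"
begin

section \<open>The ring of p-adic integers\<close>

text \<open>The inverse limit of the rings of integers modulo \<open>p ^ n\<close>: the \<open>n\<close>-th component of an
  element is its least non-negative residue modulo \<open>p ^ n\<close> (so component \<open>0\<close> is always \<open>0\<close>), and
  the components are compatible under reduction.\<close>

definition padic_int :: "nat \<Rightarrow> (nat \<Rightarrow> int) ring" where
  "padic_int p = \<lparr>
     carrier = {x. \<forall>n. 0 \<le> x n \<and> x n < int p ^ n \<and> x (Suc n) mod int p ^ n = x n},
     monoid.mult = (\<lambda>x y n. (x n * y n) mod int p ^ n),
     one = (\<lambda>n. 1 mod int p ^ n),
     zero = (\<lambda>n. 0),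
     add = (\<lambda>x y n. (x n + y n) mod int p ^ n)\<rparr>"

definition padic_cong :: "nat \<Rightarrow> nat \<Rightarrow> (nat \<Rightarrow> int) \<Rightarrow> (nat \<Rightarrow> int) \<Rightarrow> bool" where
  "padic_cong p m x y \<longleftrightarrow>
     x \<ominus>\<^bsub>padic_int p\<^esub> y \<in> PIdl\<^bsub>padic_int p\<^esub> ([(p ^ m)] \<cdot>\<^bsub>padic_int p\<^esub> \<one>\<^bsub>padic_int p\<^esub>)"

definition padic_residue :: "nat \<Rightarrow> (nat \<Rightarrow> int) \<Rightarrow> nat" where
  "padic_residue p x =
     (THE r. r < p \<and> padic_cong p 1 x ([r] \<cdot>\<^bsub>padic_int p\<^esub> \<one>\<^bsub>padic_int p\<^esub>))"

text \<open>The library's \<^const>\<open>pochhammer\<close> is restricted to type classes.\<close>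

definition ring_pochhammer :: "('a, 'b) ring_scheme \<Rightarrow> 'a \<Rightarrow> nat \<Rightarrow> 'a" where
  "ring_pochhammer R x k = (\<Otimes>\<^bsub>R\<^esub>i\<in>{..<k}. x \<oplus>\<^bsub>R\<^esub> [i] \<cdot>\<^bsub>R\<^esub> \<one>\<^bsub>R\<^esub>)"


section \<open>Euler polynomials\<close>

text \<open>The generating function \<open>2 exp (x t) / (exp t + 1)\<close> is a formal power series in \<open>t\<close> whose
  coefficients are polynomials in \<open>x\<close>; the factor \<open>2 / (exp t + 1)\<close> has constant polynomials as
  coefficients.\<close>

definition euler_gf :: "rat poly fps" where
  "euler_gf = Abs_fps (\<lambda>n. monom (1 / fact n) n) *
              Abs_fps (\<lambda>n. [:fps_nth (2 / (fps_exp 1 + 1)) n:])"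

definition euler_poly :: "nat \<Rightarrow> rat poly" where
  "euler_poly n = smult (fact n) (fps_nth euler_gf n)"

text \<open>A rational number with denominator prime to \<open>p\<close> as a \<open>p\<close>-adic integer. For other rational
  numbers the inverse does not exist and the value is meaningless; the lemma
  \<open>euler_poly_denom\<close> below shows that, for odd \<open>p\<close>, this does not occur for coefficients of
  Euler polynomials.\<close>

definition padic_of_rat :: "nat \<Rightarrow> rat \<Rightarrow> (nat \<Rightarrow> int)" where
  "padic_of_rat p q =
     ([(fst (quotient_of q))] \<cdot>\<^bsub>padic_int p\<^esub> \<one>\<^bsub>padic_int p\<^esub>) \<otimes>\<^bsub>padic_int p\<^esub>
     inv\<^bsub>padic_int p\<^esub> ([(snd (quotient_of q))] \<cdot>\<^bsub>padic_int p\<^esub> \<one>\<^bsub>padic_int p\<^esub>)"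

definition padic_poly :: "nat \<Rightarrow> rat poly \<Rightarrow> (nat \<Rightarrow> int) \<Rightarrow> (nat \<Rightarrow> int)" where
  "padic_poly p f x =
     (\<Oplus>\<^bsub>padic_int p\<^esub>i\<in>{..degree f}. padic_of_rat p (coeff f i) \<otimes>\<^bsub>padic_int p\<^esub> x [^]\<^bsub>padic_int p\<^esub> i)"


section \<open>Well-definedness\<close>

lemma padic_coherent:
  assumes "x \<in> carrier (padic_int p)" "n \<le> m"
  shows "x m mod int p ^ n = x n"
  using assms(2)
proof (induction m rule: dec_induct)
  case base
  show ?case using assms(1) by (simp add: padic_int_def)
next
  case (step m)
  have "x (Suc m) mod int p ^ n = x (Suc m) mod int p ^ m mod int p ^ n"
    using step by (simp add: le_imp_power_dvd mod_mod_cancel)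
  also have "x (Suc m) mod int p ^ m = x m" using assms(1) by (simp add: padic_int_def)
  finally show ?case using step by simp
qed

lemma padic_of_fun:
  assumes "p > 0" "\<And>n. f (Suc n) mod int p ^ n = f n mod int p ^ n"
  shows "(\<lambda>n. f n mod int p ^ n) \<in> carrier (padic_int p)"
  using assms by (simp add: padic_int_def mod_mod_cancel)

lemma padic_coh1: "x \<in> carrier (padic_int p) \<Longrightarrow> x (Suc n) mod int p ^ n = x n mod int p ^ n"
  by (simp add: padic_int_def)

lemma padic_cring:
  assumes "p > 0" shows "cring (padic_int p)"
proof (rule cringI)
  let ?Z = "padic_int p"
  have add: "x \<oplus>\<^bsub>?Z\<^esub> y \<in> carrier ?Z" if "x \<in> carrier ?Z" "y \<in> carrier ?Z" for x y
  proof -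
    have "(\<lambda>n. (x n + y n) mod int p ^ n) \<in> carrier ?Z"
      using assms by (rule padic_of_fun) (intro mod_add_cong padic_coh1 that)
    then show ?thesis by (simp add: padic_int_def)
  qed
  have mult: "x \<otimes>\<^bsub>?Z\<^esub> y \<in> carrier ?Z" if "x \<in> carrier ?Z" "y \<in> carrier ?Z" for x y
  proof -
    have "(\<lambda>n. (x n * y n) mod int p ^ n) \<in> carrier ?Z"
      using assms by (rule padic_of_fun) (intro mod_mult_cong padic_coh1 that)
    then show ?thesis by (simp add: padic_int_def)
  qed
  have neg: "\<exists>y\<in>carrier ?Z. y \<oplus>\<^bsub>?Z\<^esub> x = \<zero>\<^bsub>?Z\<^esub>" if "x \<in> carrier ?Z" for x
  proof
    show "(\<lambda>n. (- x n) mod int p ^ n) \<in> carrier ?Z"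
      using assms by (rule padic_of_fun) (intro mod_minus_cong padic_coh1 that)
    show "(\<lambda>n. (- x n) mod int p ^ n) \<oplus>\<^bsub>?Z\<^esub> x = \<zero>\<^bsub>?Z\<^esub>"
      by (simp add: padic_int_def mod_add_left_eq)
  qed
  have one: "\<one>\<^bsub>?Z\<^esub> \<in> carrier ?Z"
  proof -
    have "(\<lambda>n. 1 mod int p ^ n) \<in> carrier ?Z"
      using assms by (rule padic_of_fun) simp
    then show ?thesis by (simp add: padic_int_def)
  qed
  have zero: "\<zero>\<^bsub>?Z\<^esub> \<in> carrier ?Z" using assms by (simp add: padic_int_def)
  show "abelian_group ?Z"
    by (rule abelian_groupI[OF add zero])
      (use neg in \<open>auto simp: padic_int_def mod_add_left_eq mod_add_right_eq add_ac\<close>)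
  show "Group.comm_monoid ?Z"
    by (rule comm_monoidI[OF mult one])
      (auto simp: padic_int_def mod_mult_left_eq mod_mult_right_eq mult_ac)
  show "(x \<oplus>\<^bsub>?Z\<^esub> y) \<otimes>\<^bsub>?Z\<^esub> z = x \<otimes>\<^bsub>?Z\<^esub> z \<oplus>\<^bsub>?Z\<^esub> y \<otimes>\<^bsub>?Z\<^esub> z" for x y z
    by (simp add: padic_int_def mod_mult_left_eq mod_add_eq distrib_right)
qed

lemma padic_of_nat: "[k] \<cdot>\<^bsub>padic_int p\<^esub> \<one>\<^bsub>padic_int p\<^esub> = (\<lambda>n. int k mod int p ^ n)" for k :: nat
proof (induction k)
  case 0
  show ?case by (simp add: add_pow_def nat_pow_def padic_int_def)
next
  case (Suc k)
  have "[Suc k] \<cdot>\<^bsub>padic_int p\<^esub> \<one>\<^bsub>padic_int p\<^esub> =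
        ([k] \<cdot>\<^bsub>padic_int p\<^esub> \<one>\<^bsub>padic_int p\<^esub>) \<oplus>\<^bsub>padic_int p\<^esub> \<one>\<^bsub>padic_int p\<^esub>"
    by (simp add: add_pow_def nat_pow_def)
  also have "\<dots> = (\<lambda>n. int (Suc k) mod int p ^ n)"
    unfolding Suc by (simp add: padic_int_def mod_add_eq add.commute)
  finally show ?case .
qed

lemma padic_cong_iff:
  assumes p: "p > 0" and x: "x \<in> carrier (padic_int p)" and y: "y \<in> carrier (padic_int p)"
  shows "padic_cong p m x y \<longleftrightarrow> x m = y m"
proof -
  interpret cring "padic_int p" using p by (rule padic_cring)
  let ?Z = "padic_int p"
  define d where "d = x \<ominus>\<^bsub>?Z\<^esub> y"
  have d: "d \<in> carrier ?Z" using x y by (simp add: d_def)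
  have "x = d \<oplus>\<^bsub>?Z\<^esub> y" unfolding d_def using x y by (simp add: minus_eq add.m_assoc l_neg)
  then have xm: "x m = (d m + y m) mod int p ^ m" by (simp add: padic_int_def)
  have ym: "0 \<le> y m" "y m < int p ^ m" and dm: "0 \<le> d m" "d m < int p ^ m"
    using y d by (simp_all add: padic_int_def)
  have "x m = y m \<longleftrightarrow> (d m + y m) mod int p ^ m = (0 + y m) mod int p ^ m"
    unfolding xm using ym by simp
  also have "\<dots> \<longleftrightarrow> d m mod int p ^ m = 0"
    using cong_add_rcancel[of "d m" "y m" 0 "int p ^ m"] unfolding cong_def by simp
  finally have eq: "x m = y m \<longleftrightarrow> d m = 0" using dm by simp
  have "d \<in> PIdl\<^bsub>?Z\<^esub> ([(p ^ m)] \<cdot>\<^bsub>?Z\<^esub> \<one>\<^bsub>?Z\<^esub>) \<longleftrightarrow> d m = 0"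
  proof
    assume "d \<in> PIdl\<^bsub>?Z\<^esub> ([(p ^ m)] \<cdot>\<^bsub>?Z\<^esub> \<one>\<^bsub>?Z\<^esub>)"
    then obtain z where "d = z \<otimes>\<^bsub>?Z\<^esub> ([(p ^ m)] \<cdot>\<^bsub>?Z\<^esub> \<one>\<^bsub>?Z\<^esub>)"
      unfolding cgenideal_def by auto
    then show "d m = 0" unfolding padic_of_nat by (simp add: padic_int_def)
  next
    assume 0: "d m = 0"
    define z where "z n = d (n + m) div int p ^ m" for n
    have dz: "d (n + m) = int p ^ m * z n" for n
      using padic_coherent[OF d, of m "n + m"] 0 unfolding z_def by auto
    have z: "z \<in> carrier ?Z"
    proof -
      have "0 \<le> z n \<and> z n < int p ^ n \<and> z (Suc n) mod int p ^ n = z n" for n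
      proof (intro conjI)
        have r: "0 \<le> d (n + m)" "d (n + m) < int p ^ (n + m)"
          using d unfolding padic_int_def by auto
        show "0 \<le> z n" using r p unfolding z_def by (simp add: pos_imp_zdiv_nonneg_iff)
        show "z n < int p ^ n" using r p unfolding dz by (simp add: power_add mult.commute)
        have "d (Suc n + m) mod int p ^ (n + m) = d (n + m)"
          using d unfolding padic_int_def by auto
        then have "(int p ^ m * z (Suc n)) mod (int p ^ m * int p ^ n) = int p ^ m * z n"
          unfolding dz by (simp add: power_add mult.commute)
        then show "z (Suc n) mod int p ^ n = z n"
          using p by (simp add: mod_mult_mult1)
      qed
      then show ?thesis by (simp add: padic_int_def)
    qed
    have "d = z \<otimes>\<^bsub>?Z\<^esub> ([(p ^ m)] \<cdot>\<^bsub>?Z\<^esub> \<one>\<^bsub>?Z\<^esub>)"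
    proof
      fix n
      have "d n = d (n + m) mod int p ^ n" using padic_coherent[OF d, of n "n + m"] by simp
      then show "d n = (z \<otimes>\<^bsub>?Z\<^esub> ([(p ^ m)] \<cdot>\<^bsub>?Z\<^esub> \<one>\<^bsub>?Z\<^esub>)) n"
        unfolding padic_of_nat dz by (simp add: padic_int_def mod_mult_right_eq mult.commute)
    qed
    with z show "d \<in> PIdl\<^bsub>?Z\<^esub> ([(p ^ m)] \<cdot>\<^bsub>?Z\<^esub> \<one>\<^bsub>?Z\<^esub>)" unfolding cgenideal_def by auto
  qed
  with eq show ?thesis unfolding padic_cong_def d_def by simp
qed

lemma padic_residue_eq:
  assumes p: "p > 0" and x: "x \<in> carrier (padic_int p)"
  shows "padic_residue p x = nat (x 1)"
proof -
  interpret cring "padic_int p" using p by (rule padic_cring)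
  have x1: "0 \<le> x 1" "x 1 < int p"
  proof -
    have "0 \<le> x n \<and> x n < int p ^ n" for n using x by (simp add: padic_int_def)
    from this[of 1] show "0 \<le> x 1" "x 1 < int p" by simp_all
  qed
  have "r < p \<and> padic_cong p 1 x ([r] \<cdot>\<^bsub>padic_int p\<^esub> \<one>\<^bsub>padic_int p\<^esub>) \<longleftrightarrow> r = nat (x 1)" for r :: nat
  proof -
    have "padic_cong p 1 x ([r] \<cdot>\<^bsub>padic_int p\<^esub> \<one>\<^bsub>padic_int p\<^esub>) \<longleftrightarrow> x 1 = int r mod int p"
      by (subst padic_cong_iff[OF p x]) (simp_all add: padic_of_nat[symmetric], simp add: padic_of_nat)
    with x1 show ?thesis by auto
  qed
  then show ?thesis unfolding padic_residue_def by simp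
qed

lemma padic_unit_of_nat:
  assumes p: "p > 0" and k: "coprime k p"
  shows "[k] \<cdot>\<^bsub>padic_int p\<^esub> \<one>\<^bsub>padic_int p\<^esub> \<in> Units (padic_int p)"
proof -
  interpret cring "padic_int p" using p by (rule padic_cring)
  let ?Z = "padic_int p"
  have "\<exists>u. [int k * u = 1] (mod int p ^ n)" for n
    using k by (intro cong_solve_coprime_int) simp
  then obtain u where u: "\<And>n. [int k * u n = 1] (mod int p ^ n)" by metis
  have car: "(\<lambda>n. u n mod int p ^ n) \<in> carrier ?Z"
  proof (rule padic_of_fun[OF p])
    fix n
    have "[int k * u (Suc n) = 1] (mod int p ^ n)"
      using u[of "Suc n"] by (rule cong_dvd_modulus) simp
    then have "[int k * u (Suc n) = int k * u n] (mod int p ^ n)"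
      using u[of n] by (metis cong_sym cong_trans)
    then have "[u (Suc n) = u n] (mod int p ^ n)"
      using k by (subst (asm) cong_mult_lcancel) simp_all
    then show "u (Suc n) mod int p ^ n = u n mod int p ^ n" by (simp add: cong_def)
  qed
  have 1: "(\<lambda>n. u n mod int p ^ n) \<otimes>\<^bsub>?Z\<^esub> ([k] \<cdot>\<^bsub>?Z\<^esub> \<one>\<^bsub>?Z\<^esub>) = \<one>\<^bsub>?Z\<^esub>"
    unfolding padic_of_nat using u
    by (simp add: padic_int_def cong_def mod_mult_eq mult.commute)
  have kc: "[k] \<cdot>\<^bsub>?Z\<^esub> \<one>\<^bsub>?Z\<^esub> \<in> carrier ?Z" by simp
  have "([k] \<cdot>\<^bsub>?Z\<^esub> \<one>\<^bsub>?Z\<^esub>) \<otimes>\<^bsub>?Z\<^esub> (\<lambda>n. u n mod int p ^ n) = \<one>\<^bsub>?Z\<^esub>"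
    using 1 m_comm[OF kc car] by simp
  with 1 kc car show ?thesis
    unfolding Units_def by blast
qed

lemma euler_poly_gf:
  "Abs_fps (\<lambda>n. poly (euler_poly n) x / fact n) = 2 * fps_exp x / (fps_exp 1 + 1)"
proof -
  have "Abs_fps (\<lambda>n. poly (euler_poly n) x / fact n) = fps_exp x * (2 / (fps_exp 1 + 1))"
    by (rule fps_ext) (simp add: euler_poly_def euler_gf_def fps_mult_nth poly_sum poly_monom mult.commute)
  then show ?thesis
    by (simp add: fps_divide_unit mult_ac)
qed

lemma euler_poly_denom: "\<exists>c::int. 2 ^ n * coeff (euler_poly n) i = of_int c"
proof -
  define g :: "rat fps" where "g = 2 / (fps_exp 1 + 1)"
  define a where "a k = fact k * fps_nth g k" for k
  have "g * (fps_exp 1 + 1) = 2"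
    unfolding g_def by (simp add: fps_divide_unit mult.assoc inverse_mult_eq_1)
  then have rec0: "fps_nth (g * fps_exp 1) k + fps_nth g k = fps_nth 2 k" for k
    by (metis distrib_left fps_add_nth mult.right_neutral)
  have rec: "(\<Sum>j\<le>k. of_nat (k choose j) * a j) + a k = fact k * fps_nth 2 k" for k
  proof -
    have "fact k * fps_nth (g * fps_exp 1) k = (\<Sum>j\<le>k. of_nat (k choose j) * a j)"
      unfolding fps_mult_nth sum_distrib_left atLeast0AtMost
      by (rule sum.cong) (auto simp: a_def binomial_fact field_simps)
    then show ?thesis
      using rec0[of k] by (metis a_def distrib_left)
  qed
  have int: "2 ^ k * a k \<in> \<int>" for k
  proof (induction k rule: less_induct)
    case (less k)
    have "(\<Sum>j\<le>k. of_nat (k choose j) * a j) = (\<Sum>j<k. of_nat (k choose j) * a j) + a k"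
      by (simp add: lessThan_Suc_atMost[symmetric])
    then have *: "2 * a k = fact k * fps_nth 2 k - (\<Sum>j<k. of_nat (k choose j) * a j)"
      using rec[of k] by simp
    show ?case
    proof (cases k)
      case 0
      then show ?thesis using * by (simp add: numeral_fps_const)
    next
      case (Suc l)
      have "2 ^ k * a k = 2 ^ l * (2 * a k)" by (simp add: Suc)
      also have "\<dots> = - (\<Sum>j<k. 2 ^ l * (of_nat (k choose j) * a j))"
        unfolding * sum_distrib_left[symmetric] by (simp add: Suc numeral_fps_const del: sum.lessThan_Suc)
      also have "(\<Sum>j<k. 2 ^ l * (of_nat (k choose j) * a j)) =
                 (\<Sum>j<k. 2 ^ (l - j) * of_nat (k choose j) * (2 ^ j * a j))"
        by (rule sum.cong) (auto simp: Suc power_add[symmetric])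
      also have "- \<dots> \<in> \<int>" by (intro Ints_minus Ints_sum Ints_mult[OF Ints_mult] less.IH) auto
      finally show ?thesis .
    qed
  qed
  have "coeff (euler_poly n) i = (\<Sum>j\<le>n. if j = i then of_nat (n choose i) * a (n - i) else 0)"
    unfolding euler_poly_def euler_gf_def fps_mult_nth coeff_smult coeff_sum sum_distrib_left
      atLeast0AtMost
    by (rule sum.cong) (auto simp: a_def g_def binomial_fact)
  also have "\<dots> = (if i \<le> n then of_nat (n choose i) * a (n - i) else 0)" by simp
  finally have c: "coeff (euler_poly n) i = (if i \<le> n then of_nat (n choose i) * a (n - i) else 0)" .
  have "2 ^ n * coeff (euler_poly n) i \<in> \<int>"
  proof (cases "i \<le> n")
    case True
    then have "2 ^ n * coeff (euler_poly n) i =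
               2 ^ i * of_nat (n choose i) * (2 ^ (n - i) * a (n - i))"
      unfolding c by (simp add: power_add[symmetric])
    then show ?thesis using int[of "n - i"] by (simp add: Ints_mult Ints_power)
  qed (simp add: c)
  then show ?thesis by (auto elim: Ints_cases)
qed

end

theory Submission
  imports "HOL-Number_Theory.Residues" Defs
begin

text \<open>
  Modulo \<open>p\<^sup>4\<close> one may replace \<open>\<alpha>\<close> by a natural number \<open>A\<close>, and then \<open>(A)\<^sub>k / k!\<close> is the
  integer \<open>c(A,k) = binomial (A + k - 1) k\<close>. With \<open>F(A,k) = (-1)^k (2k + A) c(A,k)\<^sup>3\<close>, the sum
  \<open>F(A,k) + F(A+1,k)\<close> telescopes: summed over \<open>k \<le> m\<close> it is
  \<open>(-1)^m (m + 1 + 2A) c(A+1,m)\<^sup>3\<close>. Let \<open>a\<close> be the residue of \<open>- A\<close> and \<open>s = A + a\<close>, so that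
  \<open>(A, a) \<mapsto> (A + 1, a - 1)\<close> fixes \<open>s\<close>. For \<open>a > 0\<close> the closed form shows that, for the full as
  well as for the truncated sum \<open>V(a, A)\<close>,
  \<open>V(a, A) + V(a - 1, A + 1) \<equiv> 2 s\<^sup>3 A^(p - 3)\<close> modulo \<open>p\<^sup>4\<close>. The right hand side of the theorem
  satisfies the same recurrence, because \<open>E\<^sub>n(x + 1) + E\<^sub>n(x) = 2 x^n\<close>. It remains to compare
  the values at \<open>a = 0\<close>, where \<open>E\<^sub>p\<^sub>-\<^sub>3(0) = 0\<close> and the terms \<open>k\<close> and \<open>p - k\<close> of the full sum
  cancel.
\<close>

section \<open>The telescoping identity and its consequences modulo powers of a prime\<close>

text \<open>The rising factorial \<open>(A)\<^sub>k\<close> divided by \<open>k!\<close>; for \<open>A = k = 0\<close> the truncated subtraction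
  still gives the correct value 1.\<close>

definition mchoose :: "nat \<Rightarrow> nat \<Rightarrow> int" where
  "mchoose A k = int ((A + k - 1) choose k)"

lemma mchoose_0 [simp]: "mchoose A 0 = 1"
  by (simp add: mchoose_def)

lemma mchoose_pascal: "mchoose (Suc A) (Suc k) = mchoose A (Suc k) + mchoose (Suc A) k"
  by (simp add: mchoose_def)

text \<open>This is \<open>A (A+1)_k = (A)_(k+1)\<close> divided by \<open>k!\<close>. It links the
  binomials at \<open>A\<close> and \<open>A + 1\<close>, both in the telescoping and in the
  congruences modulo \<open>p^2\<close>.\<close>

lemma mchoose_absorb: "int A * mchoose (Suc A) k = int (Suc k) * mchoose A (Suc k)"
proof -
  have "A * ((A + k) choose k) = Suc k * ((A + k) choose Suc k)"
  proof (cases A)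
    case (Suc B)
    have "Suc k * (Suc (B + k) choose Suc k) = Suc (B + k) * ((B + k) choose k)"
      by (rule Suc_times_binomial)
    moreover have "Suc B * (Suc (B + k) choose k) = Suc (B + k) * ((B + k) choose k)"
      using binomial_absorb_comp[of "Suc (B + k)" k] by (simp add: Suc_diff_le)
    ultimately show ?thesis by (simp add: Suc)
  qed simp
  then show ?thesis unfolding mchoose_def by (metis add_Suc_right diff_Suc_1 add_Suc of_nat_mult)
qed

lemma fact_mchoose: "fact k * mchoose A k = (\<Prod>i<k. int A + int i)"
proof (induction k arbitrary: A)
  case (Suc k)
  have "fact (Suc k) * mchoose A (Suc k) = fact k * (int (Suc k) * mchoose A (Suc k))"
    by (simp add: algebra_simps)
  also have "\<dots> = int A * (fact k * mchoose (Suc A) k)"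
    by (simp add: mchoose_absorb[symmetric] del: of_nat_Suc)
  also have "\<dots> = (\<Prod>i<Suc k. int A + int i)"
    unfolding Suc prod.lessThan_Suc_shift by (simp add: algebra_simps)
  finally show ?case .
qed simp

definition cube_term :: "nat \<Rightarrow> nat \<Rightarrow> int" where
  "cube_term A k = (-1) ^ k * (2 * int k + int A) * mchoose A k ^ 3"

lemma cube_term_telescope:
  "(\<Sum>k\<le>m. cube_term A k + cube_term (Suc A) k) =
   (-1) ^ m * (int m + 1 + 2 * int A) * mchoose (Suc A) m ^ 3"
proof (induction m)
  case 0
  show ?case by (simp add: cube_term_def)
next
  case (Suc m)
  define a n b c where "a = int A" and "n = int (Suc m)"
    and "b = mchoose (Suc A) m" and "c = mchoose A (Suc m)"
  have ab: "a * b = n * c" unfolding a_def b_def c_def n_def by (rule mchoose_absorb)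
  \<comment> \<open>The defect of the closed form in the induction step is a multiple of
    \<open>n * c - a * b\<close>, which is zero by \<open>ab\<close>.\<close>
  have "(2 * n + a) * c ^ 3 + (n - a) * (b + c) ^ 3 - (n + 2 * a) * b ^ 3 =
        3 * (n * c - a * b) * (c * c + b * c + b * b)"
    by (simp add: algebra_simps power3_eq_cube)
  then have key: "(2 * n + a) * c ^ 3 + (2 * n + a + 1) * (b + c) ^ 3 =
        (n + 1 + 2 * a) * (b + c) ^ 3 + (n + 2 * a) * b ^ 3"
    using ab by (simp add: algebra_simps)
  have "cube_term A (Suc m) + cube_term (Suc A) (Suc m) =
        (-1) ^ Suc m * ((2 * n + a) * c ^ 3 + (2 * n + a + 1) * (b + c) ^ 3)"
    by (simp add: cube_term_def mchoose_pascal a_def n_def b_def c_def algebra_simps)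
  moreover have "(\<Sum>k\<le>m. cube_term A k + cube_term (Suc A) k) = - ((-1) ^ Suc m * ((n + 2 * a) * b ^ 3))"
    unfolding Suc by (simp add: a_def n_def b_def)
  ultimately have "(\<Sum>k\<le>Suc m. cube_term A k + cube_term (Suc A) k) =
        (-1) ^ Suc m * ((2 * n + a) * c ^ 3 + (2 * n + a + 1) * (b + c) ^ 3 - (n + 2 * a) * b ^ 3)"
    by (simp add: right_diff_distrib)
  also have "\<dots> = (-1) ^ Suc m * (n + 1 + 2 * a) * (b + c) ^ 3"
    unfolding key by simp
  finally show ?case
    by (simp add: mchoose_pascal a_def n_def b_def c_def add.commute)
qed

section \<open>Cubes modulo \<open>p^4\<close> and the recurrence in \<open>a\<close>\<close>

text \<open>With \<open>y = p z\<close> and \<open>x = y + p^2 m\<close>, every term of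
  \<open>x^3 - y^3\<close> carries \<open>p^4\<close>; the critical one is
  \<open>3 y^2 p^2 m\<close>.\<close>

lemma cong_cube_of_cong_square:
  fixes p x y :: int
  assumes "[x = y] (mod p ^ 2)" "p dvd y"
  shows "[x ^ 3 = y ^ 3] (mod p ^ 4)"
proof -
  obtain m where m: "x - y = p ^ 2 * m" using assms(1) by (auto simp: cong_iff_dvd_diff)
  obtain z where z: "y = p * z" using assms(2) by auto
  have x: "x = p * z + p ^ 2 * m" using m z by simp
  have "x ^ 3 - y ^ 3 = p ^ 4 * (3 * z ^ 2 * m + 3 * p * z * m ^ 2 + p ^ 2 * m ^ 3)"
    unfolding x z by (simp add: algebra_simps power2_eq_square power3_eq_cube power4_eq_xxxx)
  then show ?thesis by (simp add: cong_iff_dvd_diff)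
qed

text \<open>The cube contributes \<open>p^3\<close> and the congruence the fourth factor
  \<open>p\<close>: next to the cube of a multiple of \<open>p\<close>, everything matters only
  modulo \<open>p\<close>.\<close>

lemma cong_mult_cube:
  fixes p x y c :: int
  assumes "[x = y] (mod p)" "p dvd c"
  shows "[x * c ^ 3 = y * c ^ 3] (mod p ^ 4)"
proof -
  have "p * p ^ 3 dvd (x - y) * c ^ 3"
    using assms by (intro mult_dvd_mono dvd_power_same) (auto simp: cong_iff_dvd_diff)
  then show ?thesis by (simp add: cong_iff_dvd_diff algebra_simps power_numeral_reduce)
qed

lemma fermat_int:
  fixes p A :: nat
  assumes "prime p" "\<not> p dvd A"
  shows "[int A ^ (p - 1) = 1] (mod int p)"
  using fermat_theorem[OF assms] cong_int_iff[of "A ^ (p - 1)" 1 p] by simp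

text \<open>As \<open>p\<close> divides \<open>s\<close>, it divides \<open>c\<close>; hence
  \<open>B\<close> matters only modulo \<open>p\<close>, and \<open>A c\<close> modulo
  \<open>p^2\<close> determines \<open>A^3 c^3\<close> modulo \<open>p^4\<close>. The sign
  disappears because \<open>e * e^3 = 1\<close>. The full sum has \<open>e = 1\<close>, the
  truncated one a power of -1.\<close>

lemma cube_recurrence_cong:
  fixes p A :: nat and s c B e :: int
  assumes p: "prime p" "p > 3" and A: "\<not> p dvd A" and s: "int p dvd s"
    and c: "[int A * c = e * s] (mod int p ^ 2)" and e: "e = 1 \<or> e = -1"
    and B: "[B = 2 * int A] (mod int p)"
  shows "[e * B * c ^ 3 = 2 * int A ^ (p - 3) * s ^ 3] (mod int p ^ 4)"
proof -
  have cop: "coprime (int A) (int p)"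
    using p A by (metis coprime_commute coprime_int_iff prime_imp_coprime)
  have "int p dvd int A * c"
  proof -
    have "[int A * c = e * s] (mod int p)"
      using c by (rule cong_dvd_modulus) simp
    then show ?thesis using s by (simp add: cong_dvd_iff)
  qed
  then have pc: "int p dvd c" using cop by (metis coprime_commute coprime_dvd_mult_right_iff)
  have "[(int A * c) ^ 3 = (e * s) ^ 3] (mod int p ^ 4)"
    using c s by (intro cong_cube_of_cong_square) auto
  moreover have "(e * s) ^ 3 = e * s ^ 3" using e by auto
  ultimately have cube: "[int A ^ 3 * c ^ 3 = e * s ^ 3] (mod int p ^ 4)"
    unfolding power_mult_distrib[of "int A"] by simp
  have "[int A ^ 3 * (e * B * c ^ 3) = int A ^ 3 * (e * (2 * int A) * c ^ 3)] (mod int p ^ 4)"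
    using cong_mult_cube[OF B pc] by (metis cong_scalar_left mult.assoc)
  also have "int A ^ 3 * (e * (2 * int A) * c ^ 3) = (e * (2 * int A)) * (int A ^ 3 * c ^ 3)"
    by (simp only: ac_simps)
  also have "[\<dots> = (e * (2 * int A)) * (e * s ^ 3)] (mod int p ^ 4)"
    using cube by (rule cong_scalar_left)
  also have "(e * (2 * int A)) * (e * s ^ 3) = (2 * int A) * s ^ 3"
    using e by auto
  \<comment> \<open>Fermat inserts \<open>A^(p-1)\<close>, so that \<open>A^3\<close> splits off and
    can be cancelled at the end.\<close>
  also have "[\<dots> = (2 * int A * int A ^ (p - 1)) * s ^ 3] (mod int p ^ 4)"
    using cong_sym[OF cong_scalar_left[OF fermat_int[OF p(1) A], of "2 * int A"]] s
    by (intro cong_mult_cube) simp_all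
  also have "2 * int A * int A ^ (p - 1) * s ^ 3 = int A ^ 3 * (2 * int A ^ (p - 3) * s ^ 3)"
  proof -
    have "int A * int A ^ (p - 1) = int A ^ 3 * int A ^ (p - 3)"
      using p(2) by (simp add: power_Suc[symmetric] power_add[symmetric] del: power_Suc)
    then show ?thesis by (simp add: mult_ac)
  qed
  finally show ?thesis
    by (rule cong_mult_lcancel[THEN iffD1, rotated]) (use cop in simp)
qed

text \<open>Both sums are instances of \<open>V\<close>, and \<open>e\<close> stands for the value
  of the Euler polynomial, needed only modulo \<open>p\<close> because the cube of
  \<open>A + a\<close> multiplies it. Induction on \<open>a\<close> passes from \<open>A\<close> to
  \<open>A + 1\<close>, which keeps \<open>A + a\<close> fixed.\<close>

lemma recurrence_solution_cong:
  fixes p a A :: nat and e :: "nat \<Rightarrow> int" and V :: "nat \<Rightarrow> nat \<Rightarrow> int"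
  assumes e0: "\<And>A. p dvd A \<Longrightarrow> int p dvd e A"
    and e_rec: "\<And>A. [e A + e (Suc A) = 2 * int A ^ (p - 3)] (mod int p)"
    and V0: "\<And>A. p dvd A \<Longrightarrow> [V 0 A = int A] (mod int p ^ 4)"
    and V_rec: "\<And>a A. Suc a < p \<Longrightarrow> p dvd A + Suc a \<Longrightarrow>
      [V (Suc a) A + V a (Suc A) = 2 * int A ^ (p - 3) * int (A + Suc a) ^ 3] (mod int p ^ 4)"
    and a: "a < p" "p dvd A + a"
  shows "[V a A = (-1) ^ a * int (A + a) + int (A + a) ^ 3 * e A] (mod int p ^ 4)"
  using a
proof (induction a arbitrary: A)
  case 0
  \<comment> \<open>For \<open>a = 0\<close> both \<open>A\<close> and \<open>e A\<close> are
    multiples of \<open>p\<close>, so the cubic term vanishes.\<close>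
  have "[e A * int A ^ 3 = 0 * int A ^ 3] (mod int p ^ 4)"
    using 0 e0[of A] by (intro cong_mult_cube) (auto simp: cong_0_iff)
  then have "[int A + e A * int A ^ 3 = int A + 0] (mod int p ^ 4)"
    by (intro cong_add) auto
  then show ?case using V0[of A] 0 by (simp add: mult.commute) (metis cong_sym cong_trans)
next
  case (Suc a)
  define s where "s = int (A + Suc a)"
  have s: "int p dvd s" using Suc.prems unfolding s_def by presburger
  have IH: "[V a (Suc A) = (-1) ^ a * s + s ^ 3 * e (Suc A)] (mod int p ^ 4)"
    using Suc.IH[of "Suc A"] Suc.prems by (simp add: s_def)
  have "[(e A + e (Suc A)) * s ^ 3 = 2 * int A ^ (p - 3) * s ^ 3] (mod int p ^ 4)"
    using s by (intro cong_mult_cube e_rec)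
  then have "[V (Suc a) A + V a (Suc A) = (e A + e (Suc A)) * s ^ 3] (mod int p ^ 4)"
    using V_rec[of a A] Suc.prems unfolding s_def by (metis cong_sym cong_trans)
  from cong_diff[OF this IH] show ?case
    unfolding s_def[symmetric] by (simp add: algebra_simps)
qed

section \<open>Binomial factors modulo \<open>p^2\<close>\<close>

lemma cong_mult_square:
  fixes p x y s :: int
  assumes "[x = y] (mod p)" "p dvd s"
  shows "[s * x = s * y] (mod p ^ 2)"
proof -
  have "p * p dvd s * (x - y)"
    using assms by (intro mult_dvd_mono) (auto simp: cong_iff_dvd_diff)
  then show ?thesis by (simp add: cong_iff_dvd_diff algebra_simps power2_eq_square)
qed

lemma coprime_fact_prime_power:
  assumes "prime p" "k < p"
  shows "coprime (fact k :: int) (int p ^ n)"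
proof -
  have "coprime (fact k) p"
    using prime_imp_coprime[OF assms(1), of "fact k"] assms prime_dvd_fact_iff[of p k]
    by (simp add: coprime_commute)
  then have "coprime (int (fact k)) (int p)" by (simp only: coprime_int_iff)
  then show ?thesis by simp
qed

text \<open>The numbers \<open>A, ..., A + p - 1\<close> represent every residue class once;
  omitting \<open>A + a\<close>, which represents 0, leaves the nonzero classes.\<close>

lemma prod_consecutive_except_cong:
  fixes p A a :: nat
  assumes p: "prime p" and a: "a < p" "p dvd A + a"
  shows "[(\<Prod>i\<in>{..<p} - {a}. int A + int i) = fact (p - 1)] (mod int p)"
proof -
  let ?f = "\<lambda>i. (A + i) mod p"
  have p0: "p > 0" using a by simp
  have inj: "inj_on ?f {..<p}"
  proof
    fix i j assume "i \<in> {..<p}" "j \<in> {..<p}" "?f i = ?f j"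
    then have "[A + i = A + j] (mod p)" by (simp add: cong_def)
    then have "[i = j] (mod p)" by (simp add: cong_add_lcancel_nat)
    then show "i = j" using \<open>i \<in> _\<close> \<open>j \<in> _\<close> by (simp add: cong_def)
  qed
  have "?f ` {..<p} = {..<p}"
    using p0 by (intro card_subset_eq) (auto simp: card_image[OF inj])
  then have "?f ` ({..<p} - {a}) = {..<p} - {0}"
    using a inj_on_image_set_diff[OF inj, of "{..<p}" "{a}"] by (simp add: dvd_eq_mod_eq_0)
  moreover have "{..<p} - {0} = {1..p - 1}" using p0 by auto
  ultimately have image: "?f ` ({..<p} - {a}) = {1..p - 1}" by simp
  have bij: "bij_betw ?f ({..<p} - {a}) {1..p - 1}"
  proof (rule bij_betw_imageI)
    show "inj_on ?f ({..<p} - {a})" using inj by (rule inj_on_subset) auto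
  qed (rule image)
  have "[(\<Prod>i\<in>{..<p} - {a}. int A + int i) = (\<Prod>i\<in>{..<p} - {a}. int (?f i))] (mod int p)"
    by (intro cong_prod) (simp add: cong_def zmod_int)
  also have "(\<Prod>i\<in>{..<p} - {a}. int (?f i)) = (\<Prod>i\<in>{1..p - 1}. int i)"
    by (rule prod.reindex_bij_betw[OF bij])
  also have "\<dots> = fact (p - 1)" by (simp add: fact_prod)
  finally show ?thesis .
qed

text \<open>Multiplied by \<open>(p-1)!\<close>, the left side is the product of
  \<open>A + i\<close> over \<open>i < p\<close>. The factor \<open>A + a\<close> supplies one
  \<open>p\<close>, so the others may be reduced modulo \<open>p\<close>; they give
  \<open>(p-1)!\<close>, which is cancelled.\<close>

lemma mchoose_full_cong:
  fixes p A a :: nat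
  assumes p: "prime p" and a: "a < p" "p dvd A + a"
  shows "[int A * mchoose (Suc A) (p - 1) = int (A + a)] (mod int p ^ 2)"
proof -
  have Sp: "Suc (p - 1) = p" using a by simp
  have "fact (p - 1) * (int A * mchoose (Suc A) (p - 1)) = fact (p - 1) * (int p * mchoose A p)"
    using mchoose_absorb[of A "p - 1"] unfolding Sp by simp
  also have "\<dots> = fact p * mchoose A p"
    using fact_Suc[of "p - 1", where 'a = int] unfolding Sp by (simp add: mult_ac)
  also have "\<dots> = int (A + a) * (\<Prod>i\<in>{..<p} - {a}. int A + int i)"
    using a by (simp add: fact_mchoose prod.remove)
  also have "[\<dots> = int (A + a) * fact (p - 1)] (mod int p ^ 2)"
    using prod_consecutive_except_cong[OF p a] a by (intro cong_mult_square) presburger+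
  finally have "[fact (p - 1) * (int A * mchoose (Suc A) (p - 1)) = fact (p - 1) * int (A + a)] (mod int p ^ 2)"
    by (simp add: mult.commute)
  then show ?thesis
    using coprime_fact_prime_power[OF p, of "p - 1" 2] a by (subst (asm) cong_mult_lcancel) simp_all
qed

text \<open>Here \<open>A + a\<close> is the last factor of \<open>(A)_(a+1)\<close>, and the others
  satisfy \<open>A + i = -(a - i)\<close> modulo \<open>p\<close>, with product
  \<open>(-1)^a a!\<close>.\<close>

lemma mchoose_truncated_cong:
  fixes p A a :: nat
  assumes p: "prime p" and a: "a < p" "p dvd A + a"
  shows "[int A * mchoose (Suc A) a = (-1) ^ a * int (A + a)] (mod int p ^ 2)"
proof -
  have "fact a * (int A * mchoose (Suc A) a) = fact (Suc a) * mchoose A (Suc a)"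
    by (simp add: mchoose_absorb mult_ac del: of_nat_Suc)
  also have "\<dots> = int (A + a) * (\<Prod>i<a. int A + int i)"
    by (simp add: fact_mchoose del: fact_Suc)
  also have "[\<dots> = int (A + a) * (\<Prod>i<a. - (int a - int i))] (mod int p ^ 2)"
  proof (intro cong_mult_square cong_prod)
    show d: "int p dvd int (A + a)" using a(2) by presburger
    show "[int A + int i = - (int a - int i)] (mod int p)" for i
      using d by (simp add: cong_iff_dvd_diff)
  qed
  also have "(\<Prod>i<a. - (int a - int i)) = (-1) ^ a * (\<Prod>i<a. int a - int i)"
    by (subst prod_uminus) simp
  also have "(\<Prod>i<a. int a - int i) = fact a"
    by (simp add: fact_prod_rev lessThan_atLeast0 of_nat_diff)
  finally have "[fact a * (int A * mchoose (Suc A) a) = fact a * ((-1) ^ a * int (A + a))] (mod int p ^ 2)"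
    by (simp add: mult_ac)
  then show ?thesis
    using coprime_fact_prime_power[OF p, of a 2] a by (subst (asm) cong_mult_lcancel) simp_all
qed

text \<open>By absorption the left side is \<open>A * mchoose (A + 1) (k - 1)\<close>, and since
  \<open>p\<close> divides \<open>A\<close> the binomial may be replaced by
  \<open>mchoose 1 (k - 1) = 1\<close>.\<close>

lemma mchoose_multiple_cong:
  fixes p A k :: nat
  assumes p: "prime p" and A: "p dvd A" and k: "0 < k" "k < p"
  shows "[int k * mchoose A k = int A] (mod int p ^ 2)"
proof -
  obtain j where j: "k = Suc j" using k by (cases k) auto
  have "fact j * mchoose (Suc A) j = (\<Prod>i<j. int (Suc A) + int i)"
    by (rule fact_mchoose)
  also have "[\<dots> = (\<Prod>i<j. int (Suc 0) + int i)] (mod int p)"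
    using A by (intro cong_prod) (simp add: cong_iff_dvd_diff)
  also have "(\<Prod>i<j. int (Suc 0) + int i) = fact j * mchoose (Suc 0) j"
    by (rule fact_mchoose[symmetric])
  also have "mchoose (Suc 0) j = 1"
    by (simp add: mchoose_def)
  finally have "[mchoose (Suc A) j = 1] (mod int p)"
    using coprime_fact_prime_power[OF p, of j 1] j k by (subst (asm) cong_mult_lcancel) simp_all
  then have "[int A * mchoose (Suc A) j = int A * 1] (mod int p ^ 2)"
    using A by (intro cong_mult_square) simp_all
  then show ?thesis unfolding mchoose_absorb j by simp
qed

section \<open>Base value and recurrences of the two sums\<close>

lemma cube_sum_full_0:
  fixes p A :: nat
  assumes p: "prime p" "p > 3" and A: "p dvd A"
  shows "[(\<Sum>k\<le>p - 1. cube_term A k) = int A] (mod int p ^ 4)"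
proof -
  define f where "f k = (2 * int k + int A) * mchoose A k ^ 3" for k
  have odd: "odd p" using prime_odd_nat[OF p(1)] p(2) by simp
  have pc: "int p dvd mchoose A k" if "0 < k" "k < p" for k
  proof -
    have "[int k * mchoose A k = int A] (mod int p)"
      using mchoose_multiple_cong[OF p(1) A that] by (rule cong_dvd_modulus) simp
    then have "int p dvd int k * mchoose A k" using A by (simp add: cong_dvd_iff)
    then show ?thesis
      using that p(1) by (simp add: prime_dvd_mult_iff nat_dvd_not_less)
  qed
  \<comment> \<open>Multiplying by \<open>k^2\<close> completes the cube of
    \<open>k * mchoose A k\<close>, whose value modulo \<open>p^4\<close> does not depend on
    \<open>k\<close>.\<close>
  have k2: "[int k ^ 2 * f k = 2 * int A ^ 3] (mod int p ^ 4)" if k: "0 < k" "k < p" for k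
  proof -
    have "[int k ^ 2 * f k = int k ^ 2 * (2 * int k * mchoose A k ^ 3)] (mod int p ^ 4)"
      unfolding f_def using A
      by (intro cong_scalar_left cong_mult_cube pc k) (simp add: cong_iff_dvd_diff)
    also have "int k ^ 2 * (2 * int k * mchoose A k ^ 3) = 2 * (int k * mchoose A k) ^ 3"
      by (simp add: power2_eq_square power3_eq_cube mult_ac)
    also have "[\<dots> = 2 * int A ^ 3] (mod int p ^ 4)"
      using mchoose_multiple_cong[OF p(1) A k] A
      by (intro cong_scalar_left cong_cube_of_cong_square) simp_all
    finally show ?thesis .
  qed
  have sym: "[f (p - k) = f k] (mod int p ^ 4)" if k: "0 < k" "k < p" for k
  proof -
    have "[int k ^ 2 * f k = int (p - k) ^ 2 * f (p - k)] (mod int p ^ 4)"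
      using k2[OF k] k2[of "p - k"] k by (simp add: cong_def)
    also have "int (p - k) ^ 2 * f (p - k) =
      (int (p - k) ^ 2 * (2 * int (p - k) + int A)) * mchoose A (p - k) ^ 3"
      by (simp add: f_def mult.assoc)
    \<comment> \<open>The squares of \<open>p - k\<close> and \<open>k\<close> agree only modulo
      \<open>p\<close>, but the cube of \<open>mchoose A (p - k)\<close> supplies the missing
      \<open>p^3\<close>.\<close>
    also have "[\<dots> = (int k ^ 2 * (2 * int (p - k) + int A)) * mchoose A (p - k) ^ 3] (mod int p ^ 4)"
    proof (intro cong_mult_cube cong_mult cong_refl pc)
      have "int (p - k) ^ 2 - int k ^ 2 = int p * (int p - 2 * int k)"
        using k by (simp add: of_nat_diff algebra_simps power2_eq_square)
      then show "[int (p - k) ^ 2 = int k ^ 2] (mod int p)"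
        by (simp add: cong_iff_dvd_diff)
    qed (use k in auto)
    also have "(int k ^ 2 * (2 * int (p - k) + int A)) * mchoose A (p - k) ^ 3 = int k ^ 2 * f (p - k)"
      by (simp add: f_def mult.assoc)
    finally have "[int k ^ 2 * f k = int k ^ 2 * f (p - k)] (mod int p ^ 4)" .
    moreover have "coprime (int k ^ 2) (int p ^ 4)"
      using k p(1) by (metis coprime_commute coprime_int_iff coprime_power_left_iff
          coprime_power_right_iff nat_dvd_not_less prime_imp_coprime)
    ultimately show ?thesis
      by (subst (asm) cong_mult_lcancel) (simp_all add: cong_sym)
  qed
  define g where "g k = (-1) ^ k * f k" for k
  have "(\<Sum>k\<in>{1..p - 1}. g k) = (\<Sum>k\<in>{1..p - 1}. g (p - k))"
    by (rule sum.reindex_bij_witness[of _ "\<lambda>k. p - k" "\<lambda>k. p - k"]) auto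
  also have "[\<dots> = (\<Sum>k\<in>{1..p - 1}. - g k)] (mod int p ^ 4)"
  proof (rule cong_sum)
    fix k assume k: "k \<in> {1..p - 1}"
    have "(-1 :: int) ^ (p - k) = - ((-1) ^ k)"
      using odd k by (cases "even k") (auto simp: minus_one_power_iff)
    moreover have "[- ((-1) ^ k) * f (p - k) = - ((-1) ^ k) * f k] (mod int p ^ 4)"
      using sym[of k] k by (intro cong_scalar_left) auto
    ultimately show "[g (p - k) = - g k] (mod int p ^ 4)" by (simp add: g_def)
  qed
  \<comment> \<open>The sum is congruent to its own negative, and 2 is invertible because
    \<open>p\<close> is odd.\<close>
  finally have "int p ^ 4 dvd 2 * (\<Sum>k\<in>{1..p - 1}. g k)"
    by (simp add: sum_negf cong_iff_dvd_diff)
  moreover have "coprime (int p ^ 4) 2" using odd by simp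
  ultimately have "int p ^ 4 dvd (\<Sum>k\<in>{1..p - 1}. g k)"
    by (simp add: coprime_dvd_mult_right_iff)
  moreover have "(\<Sum>k\<le>p - 1. cube_term A k) = int A + (\<Sum>k\<in>{1..p - 1}. g k)"
    unfolding atMost_atLeast0 by (subst sum.atLeast_Suc_atMost) (simp_all add: cube_term_def g_def f_def mult.assoc)
  ultimately show ?thesis by (simp add: cong_iff_dvd_diff)
qed

lemma cube_sum_truncated_rec:
  fixes p a A :: nat
  assumes p: "prime p" "p > 3" and a: "Suc a < p" "p dvd A + Suc a"
  shows "[(\<Sum>k\<le>Suc a. cube_term A k) + (\<Sum>k\<le>a. cube_term (Suc A) k) =
          2 * int A ^ (p - 3) * int (A + Suc a) ^ 3] (mod int p ^ 4)"
proof -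
  \<comment> \<open>The second sum is one term shorter, so the telescoped sum up to
    \<open>Suc a\<close> has its last term removed. This changes the coefficient to
    \<open>A - (a + 1)\<close>, which is \<open>2 A\<close> modulo \<open>p\<close>.\<close>
  have "(\<Sum>k\<le>Suc a. cube_term A k) + (\<Sum>k\<le>a. cube_term (Suc A) k) =
        (\<Sum>k\<le>Suc a. cube_term A k + cube_term (Suc A) k) - cube_term (Suc A) (Suc a)"
    by (simp add: sum.distrib)
  also have "\<dots> = (-1) ^ Suc a * (int A - int (Suc a)) * mchoose (Suc A) (Suc a) ^ 3"
    unfolding cube_term_telescope by (simp add: cube_term_def algebra_simps)
  also have "[\<dots> = 2 * int A ^ (p - 3) * int (A + Suc a) ^ 3] (mod int p ^ 4)"
  proof (rule cube_recurrence_cong[OF p])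
    show d: "int p dvd int (A + Suc a)" using a(2) by presburger
    show "\<not> p dvd A" using a by (metis dvd_add_right_iff nat_dvd_not_less zero_less_Suc)
    show "[int A - int (Suc a) = 2 * int A] (mod int p)"
    proof -
      have "int A - int (Suc a) - 2 * int A = - int (A + Suc a)" by simp
      then show ?thesis using d unfolding cong_iff_dvd_diff by (simp only: dvd_minus_iff)
    qed
    show "(-1 :: int) ^ Suc a = 1 \<or> (-1 :: int) ^ Suc a = -1" by (simp add: minus_one_power_iff)
  qed (rule mchoose_truncated_cong[OF p(1) a])
  finally show ?thesis .
qed

lemma cube_sum_full_rec:
  fixes p a A :: nat
  assumes p: "prime p" "p > 3" and a: "Suc a < p" "p dvd A + Suc a"
  shows "[(\<Sum>k\<le>p - 1. cube_term A k) + (\<Sum>k\<le>p - 1. cube_term (Suc A) k) =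
          2 * int A ^ (p - 3) * int (A + Suc a) ^ 3] (mod int p ^ 4)"
proof -
  have "odd p" using prime_odd_nat[OF p(1)] p(2) by simp
  \<comment> \<open>Telescoping with \<open>m = p - 1\<close>: the sign is positive because
    \<open>p - 1\<close> is even, and \<open>m + 1 = p\<close>.\<close>
  then have "(\<Sum>k\<le>p - 1. cube_term A k) + (\<Sum>k\<le>p - 1. cube_term (Suc A) k) =
    1 * (int p + 2 * int A) * mchoose (Suc A) (p - 1) ^ 3"
    unfolding sum.distrib[symmetric] cube_term_telescope using p by (simp add: of_nat_diff)
  also have "[\<dots> = 2 * int A ^ (p - 3) * int (A + Suc a) ^ 3] (mod int p ^ 4)"
  proof (rule cube_recurrence_cong[OF p])
    show "int p dvd int (A + Suc a)" using a(2) by presburger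
    show "\<not> p dvd A" using a by (metis dvd_add_right_iff nat_dvd_not_less zero_less_Suc)
    show "[int p + 2 * int A = 2 * int A] (mod int p)" by (simp add: cong_iff_dvd_diff)
    show "[int A * mchoose (Suc A) (p - 1) = 1 * int (A + Suc a)] (mod int p ^ 2)"
      using mchoose_full_cong[OF p(1) a] by simp
  qed simp
  finally show ?thesis .
qed

section \<open>Euler polynomials\<close>

text \<open>In the generating functions,
  \<open>exp((x+1)t) + exp(x t) = exp(x t) (exp t + 1)\<close> cancels the denominator.\<close>

lemma euler_poly_shift: "poly (euler_poly n) (x + 1) + poly (euler_poly n) x = 2 * x ^ n"
proof -
  let ?d = "fps_exp 1 + 1 :: rat fps"
  have u: "?d \<noteq> 0" "?d $ 0 \<noteq> 0" by (auto simp: fps_eq_iff intro: exI[of _ 0])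
  have "Abs_fps (\<lambda>n. poly (euler_poly n) (x + 1) / fact n) + Abs_fps (\<lambda>n. poly (euler_poly n) x / fact n) =
        2 * fps_exp x * ?d / ?d"
    unfolding euler_poly_gf using u
    by (simp add: fps_divide_unit fps_exp_add_mult distrib_left distrib_right mult_ac)
  also have "\<dots> = 2 * fps_exp x" using u by (simp add: fps_divide_unit mult.assoc inverse_mult_eq_1')
  finally have "(Abs_fps (\<lambda>n. poly (euler_poly n) (x + 1) / fact n) +
    Abs_fps (\<lambda>n. poly (euler_poly n) x / fact n)) $ n = (2 * fps_exp x) $ n" by simp
  then show ?thesis by (simp add: numeral_fps_const field_simps)
qed

lemma euler_poly_0:
  assumes "even n" "n > 0"
  shows "poly (euler_poly n) 0 = 0"
proof -
  define g where "g = Abs_fps (\<lambda>n. poly (euler_poly n) 0 / fact n)"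
  \<comment> \<open>\<open>g(t) + g(- t) = 2\<close> for \<open>g(t) = 2 / (exp t + 1)\<close>\<close>
  define h where "h = g oo (- fps_X)"
  have g: "g * (fps_exp 1 + 1) = 2"
    unfolding g_def euler_poly_gf by (simp add: fps_divide_unit mult.assoc inverse_mult_eq_1)
  have "h * (fps_exp (-1) + 1) = (g * (fps_exp 1 + 1)) oo (- fps_X)"
    unfolding h_def by (simp add: fps_compose_mult_distrib fps_compose_add_distrib)
  then have h: "h * (fps_exp (-1) + 1) = 2"
    unfolding g by (simp add: numeral_fps_const)
  \<comment> \<open>Multiplication by \<open>exp t\<close> gives \<open>h\<close> the same
    denominator as \<open>g\<close>, so that the two can be added.\<close>
  have "h * (1 + fps_exp 1) = (h * (fps_exp (-1) + 1)) * fps_exp 1"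
    by (simp add: algebra_simps flip: fps_exp_add_mult)
  then have "h * (1 + fps_exp 1) = 2 * fps_exp 1" unfolding h .
  moreover have "(g + h) * (fps_exp 1 + 1) = g * (fps_exp 1 + 1) + h * (1 + fps_exp 1)"
    by (simp add: distrib_right add.commute)
  ultimately have "(g + h) * (fps_exp 1 + 1) = 2 * (fps_exp 1 + 1)"
    unfolding g by (simp add: distrib_left)
  moreover have "fps_exp 1 + 1 \<noteq> (0 :: rat fps)"
    by (auto simp: fps_eq_iff intro: exI[of _ 0])
  ultimately have "g + h = 2" by (metis mult_right_cancel)
  then have "(g + h) $ n = 0" using assms(2) by (simp add: numeral_fps_const)
  then have "g $ n + h $ n = 0" by simp
  moreover have "h $ n = g $ n"
    unfolding h_def fps_compose_uminus' using assms(1) by simp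
  ultimately show ?thesis by (simp add: g_def)
qed

section \<open>Integers approximating p-adic integers modulo a power of p\<close>

text \<open>The integer need not be reduced, so ring expressions at a fixed level \<open>n\<close>
  become plain integer expressions.\<close>

definition padic_approx :: "nat \<Rightarrow> nat \<Rightarrow> (nat \<Rightarrow> int) \<Rightarrow> int \<Rightarrow> bool" where
  "padic_approx p n x X \<longleftrightarrow> x \<in> carrier (padic_int p) \<and> [x n = X] (mod int p ^ n)"

lemma padic_approx_cong:
  "padic_approx p n x X \<Longrightarrow> [X = Y] (mod int p ^ n) \<Longrightarrow> padic_approx p n x Y"
  unfolding padic_approx_def using cong_trans by blast

lemma padic_cong_approx:
  assumes "p > 0" "padic_approx p n x X" "padic_approx p n y Y" "[X = Y] (mod int p ^ n)"
  shows "padic_cong p n x y"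
proof -
  have "[x n = y n] (mod int p ^ n)"
    using assms(2-4) unfolding padic_approx_def by (meson cong_sym cong_trans)
  moreover have "0 \<le> z n \<and> z n < int p ^ n" if "z \<in> carrier (padic_int p)" for z
    using that by (simp add: padic_int_def)
  ultimately show ?thesis
    using assms(2,3) padic_cong_iff[OF assms(1)] unfolding padic_approx_def
    by (simp add: cong_def)
qed

lemma padic_approx_of_nat:
  fixes k :: nat
  assumes "p > 0"
  shows "padic_approx p n ([k] \<cdot>\<^bsub>padic_int p\<^esub> \<one>\<^bsub>padic_int p\<^esub>) (int k)"
proof -
  interpret cring "padic_int p" using assms by (rule padic_cring)
  show ?thesis
    unfolding padic_approx_def by (simp, simp add: padic_of_nat)
qed

context
  fixes p n :: nat
  assumes p0: "p > 0"
begin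

interpretation cring "padic_int p" using p0 by (rule padic_cring)

lemma padic_approx_one: "padic_approx p n \<one>\<^bsub>padic_int p\<^esub> 1"
  unfolding padic_approx_def by (simp, simp add: padic_int_def)

lemma padic_approx_add:
  "padic_approx p n x X \<Longrightarrow> padic_approx p n y Y \<Longrightarrow> padic_approx p n (x \<oplus>\<^bsub>padic_int p\<^esub> y) (X + Y)"
  unfolding padic_approx_def by (auto, simp add: padic_int_def cong_add)

lemma padic_approx_mult:
  "padic_approx p n x X \<Longrightarrow> padic_approx p n y Y \<Longrightarrow> padic_approx p n (x \<otimes>\<^bsub>padic_int p\<^esub> y) (X * Y)"
  unfolding padic_approx_def by (auto, simp add: padic_int_def cong_mult)

lemma padic_approx_minus:
  assumes "padic_approx p n x X"
  shows "padic_approx p n (\<ominus>\<^bsub>padic_int p\<^esub> x) (- X)"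
proof -
  have x: "x \<in> carrier (padic_int p)" "[x n = X] (mod int p ^ n)"
    using assms by (auto simp: padic_approx_def)
  \<comment> \<open>The negative has no componentwise definition; its component is read off from
    \<open>- x + x = 0\<close>.\<close>
  have "(\<ominus>\<^bsub>padic_int p\<^esub> x \<oplus>\<^bsub>padic_int p\<^esub> x) n = \<zero>\<^bsub>padic_int p\<^esub> n"
    using l_neg[OF x(1)] by simp
  then have "[(\<ominus>\<^bsub>padic_int p\<^esub> x) n + x n = 0] (mod int p ^ n)"
    by (simp add: padic_int_def cong_def)
  from cong_diff[OF this x(2)] x(1) show ?thesis
    by (simp add: padic_approx_def)
qed

lemma padic_approx_pow:
  assumes "padic_approx p n x X"
  shows "padic_approx p n (x [^]\<^bsub>padic_int p\<^esub> (k::nat)) (X ^ k)"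
proof (induction k)
  case (Suc k)
  from padic_approx_mult[OF this assms] show ?case by (simp add: mult.commute)
qed (simp add: padic_approx_one)

lemma padic_approx_sum:
  assumes "finite I" "\<And>i. i \<in> I \<Longrightarrow> padic_approx p n (f i) (F i)"
  shows "padic_approx p n (\<Oplus>\<^bsub>padic_int p\<^esub>i\<in>I. f i) (\<Sum>i\<in>I. F i)"
  using assms
proof (induction I rule: finite_induct)
  case empty
  show ?case unfolding padic_approx_def by (simp, simp add: padic_int_def)
next
  case (insert i I)
  then have "f \<in> I \<rightarrow> carrier (padic_int p)" "f i \<in> carrier (padic_int p)"
    by (auto simp: padic_approx_def)
  then show ?case using insert by (simp add: padic_approx_add)
qed

text \<open>Stated for a numerator that is visibly a multiple of \<open>Y\<close>, so that the
  quotient is again approximated by an integer.\<close>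

lemma padic_approx_divide:
  assumes x: "padic_approx p n x (Q * Y)" and y: "padic_approx p n y Y"
    and unit: "y \<in> Units (padic_int p)"
  shows "padic_approx p n (x \<otimes>\<^bsub>padic_int p\<^esub> inv\<^bsub>padic_int p\<^esub> y) Q"
proof -
  define u where "u = inv\<^bsub>padic_int p\<^esub> y"
  have u: "padic_approx p n u (u n)" using unit by (simp add: u_def padic_approx_def)
  have "(u \<otimes>\<^bsub>padic_int p\<^esub> y) n = \<one>\<^bsub>padic_int p\<^esub> n"
    using unit by (simp add: u_def)
  then have "[Y * u n = 1] (mod int p ^ n)"
    using padic_approx_mult[OF u y] by (simp add: padic_int_def padic_approx_def cong_def mult.commute)
  from cong_scalar_left[OF this, of Q] show ?thesis
    unfolding u_def[symmetric]
    by (intro padic_approx_cong[OF padic_approx_mult[OF x u]]) (simp add: mult.assoc)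
qed

lemma ring_pochhammer_Suc:
  assumes "x \<in> carrier (padic_int p)"
  shows "ring_pochhammer (padic_int p) x (Suc k) =
    ring_pochhammer (padic_int p) x k \<otimes>\<^bsub>padic_int p\<^esub>
    (x \<oplus>\<^bsub>padic_int p\<^esub> [k] \<cdot>\<^bsub>padic_int p\<^esub> \<one>\<^bsub>padic_int p\<^esub>)"
  unfolding ring_pochhammer_def lessThan_Suc using assms
  by (subst finprod_insert) (auto intro!: m_comm finprod_closed)

lemma ring_pochhammer_0: "ring_pochhammer (padic_int p) x 0 = \<one>\<^bsub>padic_int p\<^esub>"
  by (simp add: ring_pochhammer_def)

lemma padic_approx_pochhammer:
  assumes "padic_approx p n x X"
  shows "padic_approx p n (ring_pochhammer (padic_int p) x k) (\<Prod>i<k. X + int i)"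
proof (induction k)
  case 0
  show ?case by (simp add: ring_pochhammer_0 padic_approx_one)
next
  case (Suc k)
  have "x \<in> carrier (padic_int p)" using assms by (simp add: padic_approx_def)
  from ring_pochhammer_Suc[OF this] Suc assms show ?case
    by (simp add: padic_approx_mult padic_approx_add padic_approx_of_nat[OF p0])
qed

lemma ring_pochhammer_one_unit:
  assumes "prime p" "k < p"
  shows "ring_pochhammer (padic_int p) \<one>\<^bsub>padic_int p\<^esub> k \<in> Units (padic_int p)"
  using assms(2)
proof (induction k)
  case 0
  show ?case by (simp add: ring_pochhammer_0)
next
  case (Suc k)
  have "coprime (Suc k) p"
    using Suc.prems assms(1) by (metis coprime_commute nat_dvd_not_less prime_imp_coprime zero_less_Suc)
  then have "[Suc k] \<cdot>\<^bsub>padic_int p\<^esub> \<one>\<^bsub>padic_int p\<^esub> \<in> Units (padic_int p)"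
    using p0 by (intro padic_unit_of_nat)
  moreover have "[Suc k] \<cdot>\<^bsub>padic_int p\<^esub> \<one>\<^bsub>padic_int p\<^esub> =
    \<one>\<^bsub>padic_int p\<^esub> \<oplus>\<^bsub>padic_int p\<^esub> [k] \<cdot>\<^bsub>padic_int p\<^esub> \<one>\<^bsub>padic_int p\<^esub>"
    using a_comm[of "[k] \<cdot>\<^bsub>padic_int p\<^esub> \<one>\<^bsub>padic_int p\<^esub>" "\<one>\<^bsub>padic_int p\<^esub>"] by simp
  ultimately have "\<one>\<^bsub>padic_int p\<^esub> \<oplus>\<^bsub>padic_int p\<^esub> [k] \<cdot>\<^bsub>padic_int p\<^esub> \<one>\<^bsub>padic_int p\<^esub> \<in> Units (padic_int p)"
    by (simp only:)
  then show ?case unfolding ring_pochhammer_Suc[OF one_closed] using Suc by (intro Units_m_closed) simp_all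
qed

lemma padic_of_int_nonneg:
  "0 \<le> z \<Longrightarrow> [z] \<cdot>\<^bsub>padic_int p\<^esub> \<one>\<^bsub>padic_int p\<^esub> = [nat z] \<cdot>\<^bsub>padic_int p\<^esub> \<one>\<^bsub>padic_int p\<^esub>" for z :: int
  unfolding add_pow_def int_pow_def2 by (simp only: not_less[symmetric] if_False)

lemma padic_of_int_neg:
  "z < 0 \<Longrightarrow> [z] \<cdot>\<^bsub>padic_int p\<^esub> \<one>\<^bsub>padic_int p\<^esub> =
    \<ominus>\<^bsub>padic_int p\<^esub> ([nat (- z)] \<cdot>\<^bsub>padic_int p\<^esub> \<one>\<^bsub>padic_int p\<^esub>)" for z :: int
  unfolding add_pow_def int_pow_def2 a_inv_def by (simp only: if_True)

lemma padic_approx_of_int: "padic_approx p n ([z] \<cdot>\<^bsub>padic_int p\<^esub> \<one>\<^bsub>padic_int p\<^esub>) z" for z :: int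
proof (cases "0 \<le> z")
  case True
  then show ?thesis using padic_approx_of_nat[OF p0, of n "nat z"] by (simp add: padic_of_int_nonneg)
next
  case False
  then show ?thesis using padic_approx_minus[OF padic_approx_of_nat[OF p0, of n "nat (- z)"]]
    by (simp add: padic_of_int_neg)
qed

text \<open>Any denominator \<open>D\<close> prime to \<open>p\<close> will do, not just the reduced
  one; powers of 2 are used for the Euler coefficients.\<close>

lemma padic_of_rat_cong:
  fixes q :: rat and D c :: int
  assumes p: "prime p" and D: "coprime D (int p)" and q: "of_int D * q = of_int c"
  shows "padic_of_rat p q \<in> carrier (padic_int p)"
    and "[D * padic_of_rat p q n = c] (mod int p ^ n)"
proof -
  obtain u v where uv: "quotient_of q = (u, v)" by fastforce
  have v: "v > 0" and cop: "coprime u v" and "q = of_int u / of_int v"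
    using quotient_of_denom_pos[OF uv] quotient_of_coprime[OF uv] quotient_of_div[OF uv] by auto
  then have "(of_int (D * u) :: rat) = of_int (c * v)" using q
    by (metis less_irrefl mult.assoc nonzero_eq_divide_eq of_int_0_eq_iff of_int_mult)
  then have Du: "D * u = c * v" by (simp only: of_int_eq_iff)
  \<comment> \<open>If \<open>p\<close> divided \<open>v\<close>, then \<open>D u = c v\<close>
    would force it to divide \<open>u\<close> too, against lowest terms.\<close>
  have vp: "coprime v (int p)"
  proof (rule ccontr)
    assume "\<not> coprime v (int p)"
    moreover have pp: "prime (int p)" using p by simp
    ultimately have pv: "int p dvd v" by (metis coprime_commute prime_imp_coprime)
    then have "int p dvd D * u" unfolding Du by simp
    moreover have "\<not> int p dvd D"
      using D pp by (metis coprime_absorb_right coprime_commute not_prime_unit)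
    ultimately have "int p dvd u" using pp by (simp add: prime_dvd_mult_iff)
    with pv cop pp show False by (metis coprime_common_divisor not_prime_unit)
  qed
  have unit: "[v] \<cdot>\<^bsub>padic_int p\<^esub> \<one>\<^bsub>padic_int p\<^esub> \<in> Units (padic_int p)"
    using padic_unit_of_nat[OF p0, of "nat v"] v vp
    by (simp add: padic_of_int_nonneg flip: coprime_int_iff)
  define w where "w = padic_of_rat p q"
  have weq: "w = ([u] \<cdot>\<^bsub>padic_int p\<^esub> \<one>\<^bsub>padic_int p\<^esub>) \<otimes>\<^bsub>padic_int p\<^esub>
     inv\<^bsub>padic_int p\<^esub> ([v] \<cdot>\<^bsub>padic_int p\<^esub> \<one>\<^bsub>padic_int p\<^esub>)"
    by (simp add: w_def padic_of_rat_def uv)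
  have car: "[u] \<cdot>\<^bsub>padic_int p\<^esub> \<one>\<^bsub>padic_int p\<^esub> \<in> carrier (padic_int p)"
    using padic_approx_of_int[of u] by (simp add: padic_approx_def)
  then have wcar: "w \<in> carrier (padic_int p)" unfolding weq using unit by simp
  then show "padic_of_rat p q \<in> carrier (padic_int p)" by (simp add: w_def)
  have "w \<otimes>\<^bsub>padic_int p\<^esub> ([v] \<cdot>\<^bsub>padic_int p\<^esub> \<one>\<^bsub>padic_int p\<^esub>) = [u] \<cdot>\<^bsub>padic_int p\<^esub> \<one>\<^bsub>padic_int p\<^esub>"
    unfolding weq using unit car by (simp add: m_assoc)
  moreover have "padic_approx p n (w \<otimes>\<^bsub>padic_int p\<^esub> ([v] \<cdot>\<^bsub>padic_int p\<^esub> \<one>\<^bsub>padic_int p\<^esub>)) (w n * v)"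
    using wcar by (intro padic_approx_mult padic_approx_of_int) (simp add: padic_approx_def)
  ultimately have "[w n * v = u] (mod int p ^ n)"
    using padic_approx_of_int[of u] unfolding padic_approx_def by (metis cong_sym cong_trans)
  from cong_scalar_left[OF this, of D] have "[(D * w n) * v = c * v] (mod int p ^ n)"
    by (simp add: Du mult.assoc)
  then show "[D * padic_of_rat p q n = c] (mod int p ^ n)"
    unfolding w_def[symmetric] using vp by (subst (asm) cong_mult_rcancel) simp_all
qed

end

section \<open>Values of Euler polynomials modulo powers of \<open>p\<close>\<close>

definition euler_residue :: "nat \<Rightarrow> nat \<Rightarrow> nat \<Rightarrow> nat \<Rightarrow> int" where
  "euler_residue p n m A =
     (\<Sum>i\<le>degree (euler_poly m). padic_of_rat p (coeff (euler_poly m) i) n * int A ^ i)"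

context
  fixes p m :: nat
  assumes p: "prime p" and p2: "p > 2"
begin

lemma coprime_power_2: "coprime (2 ^ m :: int) (int p ^ n)"
  using prime_odd_nat[OF p p2] by simp

lemma padic_approx_euler_poly:
  assumes "padic_approx p n x (int A)"
  shows "padic_approx p n (padic_poly p (euler_poly m) x) (euler_residue p n m A)"
proof -
  have p0: "p > 0" using p2 by simp
  have "padic_of_rat p (coeff (euler_poly m) i) \<in> carrier (padic_int p)" for i
  proof -
    obtain c where "2 ^ m * coeff (euler_poly m) i = of_int c" using euler_poly_denom by blast
    then have "of_int (2 ^ m) * coeff (euler_poly m) i = of_int c" by simp
    from padic_of_rat_cong(1)[OF p0 p _ this] show ?thesis using coprime_power_2[of 1] by simp
  qed
  then show ?thesis
    unfolding padic_poly_def euler_residue_def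
    by (intro padic_approx_sum padic_approx_mult padic_approx_pow p0 assms finite_atMost)
      (simp add: padic_approx_def)
qed

text \<open>Multiplying by \<open>2^m\<close> gives one integer polynomial for all \<open>A\<close>
  and \<open>n\<close>. Identities over the rationals become identities of integers through it, and
  \<open>2^m\<close> can be cancelled modulo the odd prime powers.\<close>

lemma euler_residue_numerator:
  obtains C where "\<And>A. rat_of_int (\<Sum>i\<le>degree (euler_poly m). C i * int A ^ i) = 2 ^ m * poly (euler_poly m) (of_nat A)"
    and "\<And>A n. [2 ^ m * euler_residue p n m A = (\<Sum>i\<le>degree (euler_poly m). C i * int A ^ i)] (mod int p ^ n)"
    and "rat_of_int (C 0) = 2 ^ m * poly (euler_poly m) 0"
proof -
  have p0: "p > 0" using p2 by simp
  obtain C where C: "\<And>i. 2 ^ m * coeff (euler_poly m) i = rat_of_int (C i)"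
    using euler_poly_denom by metis
  show thesis
  proof (rule that)
    show "rat_of_int (\<Sum>i\<le>degree (euler_poly m). C i * int A ^ i) = 2 ^ m * poly (euler_poly m) (of_nat A)" for A
      by (simp add: poly_altdef sum_distrib_left mult.assoc flip: C)
    show "rat_of_int (C 0) = 2 ^ m * poly (euler_poly m) 0"
      by (simp add: poly_0_coeff_0 flip: C)
    show "[2 ^ m * euler_residue p n m A = (\<Sum>i\<le>degree (euler_poly m). C i * int A ^ i)] (mod int p ^ n)" for A n
      unfolding euler_residue_def sum_distrib_left mult.assoc[symmetric]
    proof (intro cong_sum cong_scalar_right)
      fix i
      have "of_int (2 ^ m) * coeff (euler_poly m) i = of_int (C i)" using C by simp
      then show "[2 ^ m * padic_of_rat p (coeff (euler_poly m) i) n = C i] (mod int p ^ n)"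
        using coprime_power_2[of 1] by (intro padic_of_rat_cong(2)[OF p0 p]) simp_all
    qed
  qed
qed

lemma euler_residue_shift:
  "[euler_residue p n m A + euler_residue p n m (Suc A) = 2 * int A ^ m] (mod int p ^ n)"
proof -
  obtain C where C: "\<And>A. rat_of_int (\<Sum>i\<le>degree (euler_poly m). C i * int A ^ i) = 2 ^ m * poly (euler_poly m) (of_nat A)"
    and cong: "\<And>A n. [2 ^ m * euler_residue p n m A = (\<Sum>i\<le>degree (euler_poly m). C i * int A ^ i)] (mod int p ^ n)"
    using euler_residue_numerator by metis
  define S where "S A = (\<Sum>i\<le>degree (euler_poly m). C i * int A ^ i)" for A
  have "rat_of_int (S A + S (Suc A)) =
      2 ^ m * (poly (euler_poly m) (of_nat A + 1) + poly (euler_poly m) (of_nat A))"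
    unfolding of_int_add S_def C by (simp add: algebra_simps)
  also have "\<dots> = rat_of_int (2 ^ m * (2 * int A ^ m))"
    unfolding euler_poly_shift by simp
  finally have "S A + S (Suc A) = 2 ^ m * (2 * int A ^ m)" by (simp only: of_int_eq_iff)
  then have "[2 ^ m * (euler_residue p n m A + euler_residue p n m (Suc A)) = 2 ^ m * (2 * int A ^ m)] (mod int p ^ n)"
    using cong_add[OF cong[where A = A and n = n] cong[where A = "Suc A" and n = n]]
    by (simp add: S_def distrib_left)
  then show ?thesis
    by (subst (asm) cong_mult_lcancel[OF coprime_power_2])
qed

text \<open>The constant coefficient vanishes with \<open>E_m(0)\<close>, and every other term
  contains \<open>A\<close>.\<close>

lemma euler_residue_dvd:
  assumes m: "even m" "m > 0" and n: "n > 0" and A: "p dvd A"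
  shows "int p dvd euler_residue p n m A"
proof -
  obtain C where cong: "\<And>A n. [2 ^ m * euler_residue p n m A = (\<Sum>i\<le>degree (euler_poly m). C i * int A ^ i)] (mod int p ^ n)"
    and "rat_of_int (C 0) = 2 ^ m * poly (euler_poly m) 0"
    using euler_residue_numerator by metis
  then have C0: "C 0 = 0" using euler_poly_0[OF m] by simp
  have "int p dvd C i * int A ^ i" for i
    using A C0 by (cases i) simp_all
  then have "int p dvd (\<Sum>i\<le>degree (euler_poly m). C i * int A ^ i)" by (intro dvd_sum)
  moreover have "[2 ^ m * euler_residue p n m A = (\<Sum>i\<le>degree (euler_poly m). C i * int A ^ i)] (mod int p)"
    using cong by (rule cong_dvd_modulus) (use n in simp)
  ultimately have "int p dvd 2 ^ m * euler_residue p n m A" by (simp add: cong_dvd_iff)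
  moreover have "coprime (int p) (2 ^ m)" using coprime_power_2[of 1] by (simp add: coprime_commute)
  ultimately show ?thesis by (simp add: coprime_dvd_mult_right_iff)
qed

end

section \<open>Transfer to the p-adic integers\<close>

text \<open>One statement for both upper limits. The bound \<open>m < p\<close> makes every
  \<open>(1)_k\<close> a unit, and \<open>(A)_k^3\<close> is the integer
  \<open>mchoose A k ^ 3\<close> times \<open>(1)_k^3\<close>.\<close>

lemma padic_approx_cube_sum:
  fixes p m A :: nat and Z :: "(nat \<Rightarrow> int) ring" (structure)
  assumes p: "prime p" and m: "m < p" and Z: "Z = padic_int p" and \<alpha>: "padic_approx p n \<alpha> (int A)"
  shows "padic_approx p n
       (\<Oplus>k\<in>{0..m}.
          (\<ominus> \<one>) [^] k \<otimes> ([(2 * k)] \<cdot> \<one> \<oplus> \<alpha>) \<otimes>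
          (ring_pochhammer Z \<alpha> k [^] (3::nat) \<otimes> inv (ring_pochhammer Z \<one> k [^] (3::nat))))
       (\<Sum>k\<le>m. cube_term A k)"
  unfolding Z atMost_atLeast0
proof (rule padic_approx_sum)
  show p0: "p > 0" using p by (simp add: prime_gt_0_nat)
  interpret cring "padic_int p" using p0 by (rule padic_cring)
  let ?R = "padic_int p"
  fix k assume k: "k \<in> {0..m}"
  define x where "x = \<ominus>\<^bsub>?R\<^esub> \<one>\<^bsub>?R\<^esub> [^]\<^bsub>?R\<^esub> k \<otimes>\<^bsub>?R\<^esub> ([(2 * k)] \<cdot>\<^bsub>?R\<^esub> \<one>\<^bsub>?R\<^esub> \<oplus>\<^bsub>?R\<^esub> \<alpha>)"
  have x: "padic_approx p n x ((- 1) ^ k * (int (2 * k) + int A))"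
    unfolding x_def
    by (intro padic_approx_mult padic_approx_pow padic_approx_minus padic_approx_one
        padic_approx_add padic_approx_of_nat p0 \<alpha>)
  let ?P = "(\<Prod>i<k. 1 + int i) ^ 3"
  have P: "?P = fact k ^ 3"
    using fact_mchoose[of k 1] by (simp add: mchoose_def)
  have "padic_approx p n (ring_pochhammer ?R \<alpha> k [^]\<^bsub>?R\<^esub> (3::nat)) (mchoose A k ^ 3 * ?P)"
    using padic_approx_pow[OF p0 padic_approx_pochhammer[OF p0 \<alpha>, of k], of 3]
    unfolding P by (simp add: power_mult_distrib mult.commute flip: fact_mchoose)
  moreover have "padic_approx p n (ring_pochhammer ?R \<one>\<^bsub>?R\<^esub> k [^]\<^bsub>?R\<^esub> (3::nat)) ?P"
    by (intro padic_approx_pow padic_approx_pochhammer padic_approx_one p0)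
  moreover have "ring_pochhammer ?R \<one>\<^bsub>?R\<^esub> k [^]\<^bsub>?R\<^esub> (3::nat) \<in> Units ?R"
    using ring_pochhammer_one_unit[OF p0 p, of k] k m by (intro Units_pow_closed) simp
  ultimately have "padic_approx p n (ring_pochhammer ?R \<alpha> k [^]\<^bsub>?R\<^esub> (3::nat) \<otimes>\<^bsub>?R\<^esub>
      inv\<^bsub>?R\<^esub> (ring_pochhammer ?R \<one>\<^bsub>?R\<^esub> k [^]\<^bsub>?R\<^esub> (3::nat))) (mchoose A k ^ 3)"
    by (rule padic_approx_divide[OF p0])
  from padic_approx_mult[OF p0 x this]
  show "padic_approx p n (\<ominus>\<^bsub>?R\<^esub> \<one>\<^bsub>?R\<^esub> [^]\<^bsub>?R\<^esub> k \<otimes>\<^bsub>?R\<^esub> ([(2 * k)] \<cdot>\<^bsub>?R\<^esub> \<one>\<^bsub>?R\<^esub> \<oplus>\<^bsub>?R\<^esub> \<alpha>) \<otimes>\<^bsub>?R\<^esub>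
      (ring_pochhammer ?R \<alpha> k [^]\<^bsub>?R\<^esub> (3::nat) \<otimes>\<^bsub>?R\<^esub>
       inv\<^bsub>?R\<^esub> (ring_pochhammer ?R \<one>\<^bsub>?R\<^esub> k [^]\<^bsub>?R\<^esub> (3::nat)))) (cube_term A k)"
    unfolding x_def cube_term_def by simp
qed simp

theorem theorem1p5:
  fixes p :: nat and \<alpha> :: "nat \<Rightarrow> int" and Z :: "(nat \<Rightarrow> int) ring" (structure)
  assumes "prime p" and "p > 3" and "Z = padic_int p" and "\<alpha> \<in> carrier Z"
  shows
    "padic_cong p 4
       (\<Oplus>k\<in>{0..p - 1}.
          (\<ominus> \<one>) [^] k \<otimes> ([(2 * k)] \<cdot> \<one> \<oplus> \<alpha>) \<otimes>
          (ring_pochhammer Z \<alpha> k [^] (3::nat) \<otimes> inv (ring_pochhammer Z \<one> k [^] (3::nat))))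
       ((\<ominus> \<one>) [^] padic_residue p (\<ominus> \<alpha>) \<otimes> (\<alpha> \<oplus> [padic_residue p (\<ominus> \<alpha>)] \<cdot> \<one>) \<oplus>
        (\<alpha> \<oplus> [padic_residue p (\<ominus> \<alpha>)] \<cdot> \<one>) [^] (3::nat) \<otimes> padic_poly p (euler_poly (p - 3)) \<alpha>)
     \<and>
     padic_cong p 4
       (\<Oplus>k\<in>{0..padic_residue p (\<ominus> \<alpha>)}.
          (\<ominus> \<one>) [^] k \<otimes> ([(2 * k)] \<cdot> \<one> \<oplus> \<alpha>) \<otimes>
          (ring_pochhammer Z \<alpha> k [^] (3::nat) \<otimes> inv (ring_pochhammer Z \<one> k [^] (3::nat))))
       ((\<ominus> \<one>) [^] padic_residue p (\<ominus> \<alpha>) \<otimes> (\<alpha> \<oplus> [padic_residue p (\<ominus> \<alpha>)] \<cdot> \<one>) \<oplus>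
        (\<alpha> \<oplus> [padic_residue p (\<ominus> \<alpha>)] \<cdot> \<one>) [^] (3::nat) \<otimes> padic_poly p (euler_poly (p - 3)) \<alpha>)"
proof -
  note p = assms(1,2) and Z = assms(3)
  have p0: "p > 0" and p2: "p > 2" using p by auto
  interpret cring Z unfolding Z using p0 by (rule padic_cring)
  have \<alpha>: "\<alpha> \<in> carrier (padic_int p)" using assms(4) Z by simp
  have comp: "0 \<le> x n \<and> x n < int p ^ n" if "x \<in> carrier (padic_int p)" for x n
    using that by (simp add: padic_int_def)
  \<comment> \<open>The natural number replacing \<open>\<alpha>\<close> is its residue modulo
    \<open>p^4\<close>.\<close>
  define A where "A = nat (\<alpha> 4)"
  have A: "int A = \<alpha> 4" using comp[OF \<alpha>, of 4] by (simp add: A_def)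
  have approx: "padic_approx p 4 \<alpha> (int A)" using \<alpha> by (simp add: padic_approx_def A)
  define r where "r = padic_residue p (\<ominus> \<alpha>)"
  have m\<alpha>: "\<ominus> \<alpha> \<in> carrier (padic_int p)" using assms(4) unfolding Z[symmetric] by simp
  have r: "int r = (\<ominus> \<alpha>) 1"
    unfolding r_def using padic_residue_eq[OF p0 m\<alpha>] comp[OF m\<alpha>, of 1] by simp
  then have rp: "r < p" using comp[OF m\<alpha>, of 1] by simp
  \<comment> \<open>Modulo \<open>p\<close>, \<open>r\<close> is the residue of
    \<open>- \<alpha>\<close> and, by coherence of levels 1 and 4, \<open>A\<close> that of
    \<open>\<alpha>\<close>; so \<open>p\<close> divides \<open>A + r\<close>.\<close>
  have "padic_approx p 1 (\<ominus> \<alpha>) (- (\<alpha> 1))"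
    unfolding Z using \<alpha> by (intro padic_approx_minus p0) (simp add: padic_approx_def)
  then have "[int r = - (\<alpha> 1)] (mod int p)" by (simp add: padic_approx_def r)
  moreover have "[\<alpha> 1 = int A] (mod int p)"
    using padic_coherent[OF \<alpha>, of 1 4] comp[OF \<alpha>, of 1] A by (simp add: cong_def)
  ultimately have "[int r + \<alpha> 1 = - (\<alpha> 1) + int A] (mod int p)" by (rule cong_add)
  then have "int p dvd int A + int r"
    using \<open>[\<alpha> 1 = int A] (mod int p)\<close> \<open>[int r = - (\<alpha> 1)] (mod int p)\<close>
    by (metis add.commute add.right_inverse cong_0_iff cong_add cong_sym)
  then have rA: "p dvd A + r" by (simp flip: of_nat_add)
  define e where "e = euler_residue p 4 (p - 3)"
  \<comment> \<open>Together with \<open>p > 3\<close> this makes \<open>p - 3\<close> even and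
    positive, as the vanishing of \<open>E_(p-3)(0)\<close> requires.\<close>
  have even: "even (p - 3)" using prime_odd_nat[OF p(1) p2] p(2) by simp
  have e0: "int p dvd e A" if "p dvd A" for A
    unfolding e_def using even p(2) that by (intro euler_residue_dvd[OF p(1) p2]) simp_all
  have e_rec: "[e A + e (Suc A) = 2 * int A ^ (p - 3)] (mod int p)" for A
    unfolding e_def using euler_residue_shift[OF p(1) p2] by (rule cong_dvd_modulus) simp
  have rhs: "padic_approx p 4
       ((\<ominus> \<one>) [^] r \<otimes> (\<alpha> \<oplus> [r] \<cdot> \<one>) \<oplus> (\<alpha> \<oplus> [r] \<cdot> \<one>) [^] (3::nat) \<otimes> padic_poly p (euler_poly (p - 3)) \<alpha>)
       ((- 1) ^ r * int (A + r) + int (A + r) ^ 3 * e A)"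
    unfolding Z e_def of_nat_add
    by (intro padic_approx_add padic_approx_mult padic_approx_pow padic_approx_minus padic_approx_one
        padic_approx_of_nat padic_approx_euler_poly p0 p(1) p2 approx)
  \<comment> \<open>For the full sum \<open>V\<close> ignores its first argument; \<open>a\<close>
    enters only through divisibility of \<open>A + a\<close>.\<close>
  have "[(\<Sum>k\<le>p - 1. cube_term A k) = (- 1) ^ r * int (A + r) + int (A + r) ^ 3 * e A] (mod int p ^ 4)"
    by (rule recurrence_solution_cong[where V = "\<lambda>_ A. \<Sum>k\<le>p - 1. cube_term A k"])
      (use e0 e_rec cube_sum_full_0 cube_sum_full_rec p rp rA in auto)
  moreover have "[(\<Sum>k\<le>r. cube_term A k) = (- 1) ^ r * int (A + r) + int (A + r) ^ 3 * e A] (mod int p ^ 4)"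
    by (rule recurrence_solution_cong[where V = "\<lambda>a A. \<Sum>k\<le>a. cube_term A k"])
      (use e0 e_rec cube_sum_truncated_rec p rp rA in \<open>auto simp: cube_term_def\<close>)
  ultimately show ?thesis
    unfolding r_def[symmetric] using p0 rp
    by (intro conjI padic_cong_approx[OF p0 padic_approx_cube_sum[OF p(1) _ Z approx] rhs]) simp_all
qed

end
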